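(* For $\ell>0$ let $\tilde c(\ell)\ge0$ be given by $\tilde c^{\,2}(\ell)=1-1/\ell^2$ if $\ell>1$ and $\tilde c(\ell)=0$ if $0<\ell\le1$, and let $\tilde s(\ell)=\sqrt{1-\tilde c^{\,2}(\ell)}$. For $\vartheta\in\mathbb R$ and $\star\in\{F,O,N\}$ put $$\tilde{\mathcal L}_\star(\ell,\vartheta)=\left\|\begin{bmatrix}\ell-\vartheta\tilde c^{\,2}(\ell)&-\vartheta\tilde c(\ell)\tilde s(\ell)\\-\vartheta\tilde c(\ell)\tilde s(\ell)&-\vartheta\tilde s^{\,2}(\ell)\end{bmatrix}\right\|_\star .$$ Let $\tilde{\mathcal L}^1_\star(\ell)=\min_{\vartheta\in\mathbb R}\tilde{\mathcal L}_\star(\ell,\vartheta)$. Then for every $\ell>0$ the minimum is attained at $\vartheta=\tilde\eta^*(\ell|\star)$, where $$\tilde\eta^*(\ell|F)=(\ell-1/\ell)_+,\qquad \tilde\eta^*(\ell|O)=\ell\cdot1_{\{\ell>1\}},\qquad \tilde\eta^*(\ell|N)=(\ell-2/\ell)_+,$$ and the minimal values are $$\tilde{\mathcal L}_F^1(\ell)=\begin{cases}\sqrt{2-1/\ell^2}&\ell>1\\ \ell&0<\ell\le1\end{cases},\quad \tilde{\mathcal L}_O^1(\ell)=\begin{cases}1&\ell>1\\ \ell&0<\ell\le1\end{cases},\quad \tilde{\mathcal L}_N^1(\ell)=\begin{cases}2\sqrt{1-1/\ell^2}&\ell>\sqrt2\\ \ell&0<\ell\le\sqrt2\end{cases}.$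$
   Context: $\|\cdot\|_F,\|\cdot\|_O,\|\cdot\|_N$ denote the Frobenius, operator (spectral) and nuclear matrix norms. $x_+=\max(x,0)$. The function $\tilde{\mathcal L}_\star(\ell,\vartheta)$ is the asymptotic rank-one loss of eigenvalue shrinkage in the spiked covariance model as $p/n\to0$, and $\tilde{\mathcal L}_\star^1$, $\tilde\eta^*(\cdot|\star)$ are called the formally optimal asymptotic loss and a formally optimal shrinker. *)

theory Defs
  imports "HOL-Analysis.Analysis"
begin

definition frobenius_norm :: "real ^ 'n ^ 'm \<Rightarrow> real" where
  "frobenius_norm A = sqrt (\<Sum>i\<in>UNIV. \<Sum>j\<in>UNIV. (A $ i $ j)\<^sup>2)"

definition operator_norm :: "real ^ 'n ^ 'm \<Rightarrow> real" where
  "operator_norm A = onorm ((*v) A)"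

definition eigenspace :: "real ^ 'n ^ 'n \<Rightarrow> real \<Rightarrow> (real ^ 'n) set" where
  "eigenspace B \<mu> = {v. B *v v = \<mu> *\<^sub>R v}"

definition eigenvalues :: "real ^ 'n ^ 'n \<Rightarrow> real set" where
  "eigenvalues B = {\<mu>. \<exists>v\<in>eigenspace B \<mu>. v \<noteq> 0}"

text \<open>The sum of the singular values, i.e. of the square roots of the eigenvalues of
  the Gram matrix, counted with multiplicity. As the Gram matrix is symmetric,
  the multiplicity of an eigenvalue is the dimension of its eigenspace.\<close>

definition nuclear_norm :: "real ^ 'n ^ 'm \<Rightarrow> real" where
  "nuclear_norm A =
     (\<Sum>\<mu>\<in>eigenvalues (transpose A ** A).
        real (dim (eigenspace (transpose A ** A) \<mu>)) * sqrt \<mu>)"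

datatype norm_type = Frobenius | Operator | Nuclear

fun matrix_norm :: "norm_type \<Rightarrow> real ^ 'n ^ 'm \<Rightarrow> real" where
  "matrix_norm Frobenius A = frobenius_norm A"
| "matrix_norm Operator A = operator_norm A"
| "matrix_norm Nuclear A = nuclear_norm A"

definition c_tilde :: "real \<Rightarrow> real" where
  "c_tilde l = (if l > 1 then sqrt (1 - 1 / l\<^sup>2) else 0)"

definition s_tilde :: "real \<Rightarrow> real" where
  "s_tilde l = sqrt (1 - (c_tilde l)\<^sup>2)"

definition loss_matrix :: "real \<Rightarrow> real \<Rightarrow> real ^ 2 ^ 2" where
  "loss_matrix l \<theta> = vector
     [vector [l - \<theta> * (c_tilde l)\<^sup>2, - \<theta> * c_tilde l * s_tilde l],
      vector [- \<theta> * c_tilde l * s_tilde l, - \<theta> * (s_tilde l)\<^sup>2]]"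

definition loss :: "norm_type \<Rightarrow> real \<Rightarrow> real \<Rightarrow> real" where
  "loss k l \<theta> = matrix_norm k (loss_matrix l \<theta>)"

text \<open>The minimum over all real \<open>\<theta>\<close>. The value is unspecified if no minimum exists,
  so attainment has to be established separately.\<close>

definition optimal_loss :: "norm_type \<Rightarrow> real \<Rightarrow> real" where
  "optimal_loss k l = (LEAST m. m \<in> range (loss k l))"

fun optimal_shrinker :: "norm_type \<Rightarrow> real \<Rightarrow> real" where
  "optimal_shrinker Frobenius l = max (l - 1 / l) 0"
| "optimal_shrinker Operator l = l * of_bool (l > 1)"
| "optimal_shrinker Nuclear l = max (l - 2 / l) 0"

end

theory Submission
  imports Defs
begin

text \<open>With \<open>u = (c, s)\<close> a unit vector, the loss matrix is \<open>M = l e\<^sub>1 e\<^sub>1\<^sup>T - \<theta> u u\<^sup>T\<close>, so that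
  \<open>\<parallel>M\<parallel>\<^sub>F\<^sup>2 = l\<^sup>2 - 2 \<theta> l c\<^sup>2 + \<theta>\<^sup>2\<close> and \<open>det M = - \<theta> l s\<^sup>2\<close>. The Frobenius case is the minimum of a
  quadratic. A \<open>2 \<times> 2\<close> matrix satisfies \<open>\<parallel>M\<parallel>\<^sub>N\<^sup>2 = \<parallel>M\<parallel>\<^sub>F\<^sup>2 + 2 \<bar>det M\<bar>\<close>, which makes the nuclear
  case a minimum of two quadratics glued at \<open>\<theta> = 0\<close>. For the operator norm, the unit vector
  \<open>v = (s, - c)\<close> orthogonal to \<open>u\<close> has \<open>M v = l s e\<^sub>1\<close> for every \<open>\<theta>\<close>; the bound \<open>l s\<close> is attained at
  \<open>\<theta> = l\<close>, where \<open>M\<close> is \<open>l s\<close> times a reflection, and for \<open>l \<le> 1\<close>, where \<open>c = 0\<close>, also at \<open>\<theta> = 0\<close>.\<close>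

section \<open>Eigenvalues and eigenspaces of \<open>2 \<times> 2\<close> matrices\<close>

lemma matrix_vector_mult_2:
  fixes A :: "real ^ 2 ^ 2"
  shows "(A *v x) $ i = A $ i $ 1 * x $ 1 + A $ i $ 2 * x $ 2"
  by (simp add: matrix_vector_mult_def sum_2)

lemma norm_2: "norm (x :: real ^ 2) = sqrt ((x $ 1)\<^sup>2 + (x $ 2)\<^sup>2)"
  by (simp add: norm_vec_def L2_set_def sum_2)

lemma mem_eigenspace_2:
  fixes B :: "real ^ 2 ^ 2"
  shows "v \<in> eigenspace B \<mu> \<longleftrightarrow>
    (B $ 1 $ 1 - \<mu>) * v $ 1 + B $ 1 $ 2 * v $ 2 = 0 \<and>
    B $ 2 $ 1 * v $ 1 + (B $ 2 $ 2 - \<mu>) * v $ 2 = 0"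
  by (auto simp: eigenspace_def vec_eq_iff forall_2 matrix_vector_mult_2 algebra_simps)

lemma subspace_eigenspace: "subspace (eigenspace B \<mu>)"
  by (auto simp: subspace_def eigenspace_def matrix_vector_right_distrib scaleR_add_right
      matrix_vector_mult_scaleR mult.commute)

text \<open>A nonzero vector in the kernel of \<open>B - mat \<mu>\<close> exists exactly when this
  matrix is singular.\<close>

lemma eigenvalues_2:
  fixes B :: "real ^ 2 ^ 2"
  shows "\<mu> \<in> eigenvalues B \<longleftrightarrow> \<mu>\<^sup>2 - trace B * \<mu> + det B = 0"
proof -
  have eigenspace: "eigenspace B \<mu> = {v. (B - mat \<mu>) *v v = 0}"
    by (auto simp: mem_eigenspace_2 vec_eq_iff forall_2 matrix_vector_mult_2 mat_def)
  have "\<mu> \<in> eigenvalues B \<longleftrightarrow> det (B - mat \<mu>) = 0"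
    unfolding eigenvalues_def mem_Collect_eq eigenspace
    using invertible_det_nz[of "B - mat \<mu>"] matrix_left_invertible_ker[of "B - mat \<mu>"]
      invertible_left_inverse[of "B - mat \<mu>"] by auto
  also have "det (B - mat \<mu>) = \<mu>\<^sup>2 - trace B * \<mu> + det B"
    by (simp add: det_2 trace_def sum_2 mat_def power2_eq_square algebra_simps)
  finally show ?thesis .
qed

text \<open>The eigenspace for \<open>a\<close> is nonzero and misses an eigenvector for
  \<open>b\<close>, so its dimension is neither 0 nor 2.\<close>

lemma dim_eigenspace_2_distinct:
  fixes B :: "real ^ 2 ^ 2"
  assumes "a \<in> eigenvalues B" "b \<in> eigenvalues B" "a \<noteq> b"
  shows "dim (eigenspace B a) = 1"
proof -
  obtain v where v: "v \<in> eigenspace B a" "v \<noteq> 0"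
    using assms(1) by (auto simp: eigenvalues_def)
  obtain w where w: "w \<in> eigenspace B b" "w \<noteq> 0"
    using assms(2) by (auto simp: eigenvalues_def)
  have "w \<notin> eigenspace B a"
    using w \<open>a \<noteq> b\<close> by (auto simp: eigenspace_def)
  then have "span (eigenspace B a) \<noteq> UNIV"
    using subspace_eigenspace[of B a] by (metis span_eq_iff UNIV_I)
  then have "dim (eigenspace B a) \<noteq> 2"
    using dim_eq_full[of "eigenspace B a"] by simp
  moreover have "dim (eigenspace B a) \<noteq> 0"
    using v by (auto simp: dim_eq_0)
  moreover have "dim (eigenspace B a) \<le> 2"
    using dim_subset_UNIV[of "eigenspace B a"] by simp
  ultimately show ?thesis
    by linarith
qed

text \<open>Symmetry makes the discriminant \<open>D\<close> a sum of squares, so both roots are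
  real. It also makes the geometric multiplicities add up to 2, so a sum weighted by them runs over
  the roots \<open>a\<close>, \<open>b\<close> with repetition.\<close>

lemma sum_eigenvalues_symmetric_2:
  fixes B :: "real ^ 2 ^ 2"
  assumes "transpose B = B"
  obtains a b where "a + b = trace B" "a * b = det B"
    "\<And>f. (\<Sum>\<mu>\<in>eigenvalues B. real (dim (eigenspace B \<mu>)) * f \<mu>) = f a + f b"
proof -
  have sym: "B $ 2 $ 1 = B $ 1 $ 2"
    using arg_cong[OF assms, of "\<lambda>A. A $ 1 $ 2"] by (simp add: transpose_def)
  define D where "D = (trace B)\<^sup>2 - 4 * det B"
  have D: "D = (B $ 1 $ 1 - B $ 2 $ 2)\<^sup>2 + 4 * (B $ 1 $ 2)\<^sup>2"
    by (simp add: D_def trace_def sum_2 det_2 sym power2_eq_square algebra_simps)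
  define a b where "a = (trace B + sqrt D) / 2" and "b = (trace B - sqrt D) / 2"
  have "D \<ge> 0"
    by (simp add: D)
  have "a + b = trace B"
    by (simp add: a_def b_def field_simps)
  moreover have "a * b = ((trace B)\<^sup>2 - (sqrt D)\<^sup>2) / 4"
    by (simp add: a_def b_def power2_eq_square algebra_simps)
  then have "a * b = det B"
    using \<open>D \<ge> 0\<close> by (simp add: D_def)
  ultimately have ab: "a + b = trace B" "a * b = det B" .
  have "\<mu> \<in> eigenvalues B \<longleftrightarrow> (\<mu> - a) * (\<mu> - b) = 0" for \<mu>
    unfolding eigenvalues_2 ab[symmetric] by (simp add: power2_eq_square algebra_simps)
  then have ev: "eigenvalues B = {a, b}"
    by auto
  have "(\<Sum>\<mu>\<in>eigenvalues B. real (dim (eigenspace B \<mu>)) * f \<mu>) = f a + f b" for f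
  proof (cases "a = b")
    case True
    then have "D = 0"
      using \<open>D \<ge> 0\<close> by (simp add: a_def b_def)
    \<comment> \<open>A vanishing sum of squares leaves only scalar matrices, whose eigenspace is
      the whole plane.\<close>
    then have "B $ 1 $ 1 = B $ 2 $ 2 \<and> B $ 1 $ 2 = 0"
      unfolding D by (simp add: add_nonneg_eq_0_iff)
    moreover from this have "a = B $ 1 $ 1"
      using \<open>D = 0\<close> by (simp add: a_def trace_def sum_2)
    ultimately have "eigenspace B a = UNIV"
      by (auto simp: mem_eigenspace_2 sym)
    then show ?thesis
      using True by (simp add: ev)
  next
    case False
    then show ?thesis
      using dim_eigenspace_2_distinct[of a B b] dim_eigenspace_2_distinct[of b B a] ev by simp
  qed
  with ab show ?thesis
    using that by blast
qed

section \<open>Frobenius and nuclear norms of \<open>2 \<times> 2\<close> matrices\<close>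

lemma frobenius_norm_2:
  fixes A :: "real ^ 2 ^ 2"
  shows "(frobenius_norm A)\<^sup>2 =
    (A $ 1 $ 1)\<^sup>2 + (A $ 1 $ 2)\<^sup>2 + (A $ 2 $ 1)\<^sup>2 + (A $ 2 $ 2)\<^sup>2"
  by (simp add: frobenius_norm_def sum_2)

text \<open>The squared singular values \<open>a\<close>, \<open>b\<close> have sum
  \<open>(frobenius_norm A)\<^sup>2\<close> and product \<open>(det A)\<^sup>2\<close>; the
  determinant enters through the cross term of \<open>(sqrt a + sqrt b)\<^sup>2\<close>.\<close>

lemma nuclear_norm_2:
  fixes A :: "real ^ 2 ^ 2"
  shows "nuclear_norm A = sqrt ((frobenius_norm A)\<^sup>2 + 2 * \<bar>det A\<bar>)"
proof -
  let ?G = "transpose A ** A"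
  have "transpose ?G = ?G"
    by (simp add: matrix_transpose_mul)
  then obtain a b where ab: "a + b = trace ?G" "a * b = det ?G"
    and "\<And>f. (\<Sum>\<mu>\<in>eigenvalues ?G. real (dim (eigenspace ?G \<mu>)) * f \<mu>) = f a + f b"
    by (rule sum_eigenvalues_symmetric_2) blast
  then have sum: "nuclear_norm A = sqrt a + sqrt b"
    by (simp add: nuclear_norm_def)
  have tr: "a + b = (frobenius_norm A)\<^sup>2"
    unfolding ab frobenius_norm_2
    by (simp add: trace_def sum_2 matrix_matrix_mult_def transpose_def power2_eq_square)
  have det: "a * b = (det A)\<^sup>2"
    by (simp add: ab det_mul power2_eq_square)
  \<comment> \<open>The product excludes opposite signs, the sum excludes two negative
    values.\<close>
  have "a + b \<ge> 0" "a * b \<ge> 0"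
    by (simp_all add: tr det)
  then have nonneg: "a \<ge> 0" "b \<ge> 0"
    by (auto simp: zero_le_mult_iff)
  have "(sqrt a + sqrt b)\<^sup>2 = a + b + 2 * sqrt (a * b)"
    using nonneg by (simp add: power2_sum real_sqrt_mult)
  also have "\<dots> = (frobenius_norm A)\<^sup>2 + 2 * \<bar>det A\<bar>"
    by (simp add: tr det)
  finally show ?thesis
    using nonneg by (simp add: sum real_sqrt_unique)
qed

section \<open>Closed forms for the loss matrix\<close>

lemma s_tilde_eq:
  assumes "l > 0"
  shows "s_tilde l = (if l > 1 then 1 / l else 1)"
  using assms by (auto simp: s_tilde_def c_tilde_def real_sqrt_divide)

lemma c_tilde_sq:
  assumes "l > 0"
  shows "(c_tilde l)\<^sup>2 = (if l > 1 then 1 - 1 / l\<^sup>2 else 0)"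
  using assms by (auto simp: c_tilde_def)

lemma c_tilde_sq_add_s_tilde_sq:
  assumes "l > 0"
  shows "(c_tilde l)\<^sup>2 + (s_tilde l)\<^sup>2 = 1"
  using assms by (auto simp: c_tilde_sq s_tilde_eq power_divide)

lemma loss_matrix_nth:
  "loss_matrix l \<theta> $ 1 $ 1 = l - \<theta> * (c_tilde l)\<^sup>2"
  "loss_matrix l \<theta> $ 1 $ 2 = - \<theta> * c_tilde l * s_tilde l"
  "loss_matrix l \<theta> $ 2 $ 1 = - \<theta> * c_tilde l * s_tilde l"
  "loss_matrix l \<theta> $ 2 $ 2 = - \<theta> * (s_tilde l)\<^sup>2"
  by (simp_all add: loss_matrix_def)

text \<open>The terms quadratic in \<open>\<theta>\<close> cancel because the matrix multiplied by
  \<open>\<theta>\<close> has rank one.\<close>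

lemma det_loss_matrix: "det (loss_matrix l \<theta>) = - \<theta> * l * (s_tilde l)\<^sup>2"
  by (simp add: det_2 loss_matrix_nth power2_eq_square algebra_simps)

lemma frobenius_norm_loss_matrix:
  assumes "l > 0"
  shows "(frobenius_norm (loss_matrix l \<theta>))\<^sup>2 = l\<^sup>2 - 2 * \<theta> * l * (c_tilde l)\<^sup>2 + \<theta>\<^sup>2"
proof -
  have "(frobenius_norm (loss_matrix l \<theta>))\<^sup>2 =
      l\<^sup>2 - 2 * \<theta> * l * (c_tilde l)\<^sup>2 + \<theta>\<^sup>2 * ((c_tilde l)\<^sup>2 + (s_tilde l)\<^sup>2)\<^sup>2"
    unfolding frobenius_norm_2 loss_matrix_nth by (simp add: power2_eq_square algebra_simps)
  then show ?thesis
    using assms by (simp add: c_tilde_sq_add_s_tilde_sq)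
qed

lemma loss_Frobenius:
  assumes "l > 0"
  shows "loss Frobenius l \<theta> = sqrt (l\<^sup>2 - 2 * \<theta> * l * (c_tilde l)\<^sup>2 + \<theta>\<^sup>2)"
proof -
  have "frobenius_norm (loss_matrix l \<theta>) \<ge> 0"
    by (simp add: frobenius_norm_def sum_nonneg)
  then show ?thesis
    using frobenius_norm_loss_matrix[OF assms, of \<theta>] by (simp add: loss_def real_sqrt_unique)
qed

lemma loss_Nuclear:
  assumes "l > 0"
  shows "loss Nuclear l \<theta> =
    sqrt (l\<^sup>2 - 2 * \<theta> * l * (c_tilde l)\<^sup>2 + \<theta>\<^sup>2 + 2 * \<bar>\<theta>\<bar> * l * (s_tilde l)\<^sup>2)"
  using assms
  by (simp add: loss_def nuclear_norm_2 frobenius_norm_loss_matrix det_loss_matrix abs_mult)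

section \<open>Minimisation over \<open>\<theta>\<close> for each norm\<close>

text \<open>A lower bound that is attained is the least element of the range, so each norm needs
  only a bound and the value at the shrinker.\<close>

lemma optimal_lossI:
  assumes "\<And>\<theta>. m \<le> loss k l \<theta>" and "loss k l (optimal_shrinker k l) = m"
  shows "(\<forall>\<theta>. loss k l (optimal_shrinker k l) \<le> loss k l \<theta>) \<and>
    optimal_loss k l = loss k l (optimal_shrinker k l) \<and> optimal_loss k l = m"
proof -
  have "optimal_loss k l = m"
    unfolding optimal_loss_def using assms by (intro Least_equality) auto
  with assms show ?thesis
    by simp
qed

text \<open>The quadratic under the root has its vertex at \<open>l * (c_tilde l)\<^sup>2\<close>,
  which is \<open>l - 1 / l\<close> for \<open>l > 1\<close> and 0 otherwise.\<close>

lemma loss_Frobenius_ge: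
  assumes "l > 0"
  shows "(if l > 1 then sqrt (2 - 1 / l\<^sup>2) else l) \<le> loss Frobenius l \<theta>"
proof (cases "l > 1")
  case True
  have "l\<^sup>2 - 2 * \<theta> * l * (1 - 1 / l\<^sup>2) + \<theta>\<^sup>2 - (2 - 1 / l\<^sup>2) = (\<theta> - (l - 1 / l))\<^sup>2"
    using assms by (simp add: field_simps power2_eq_square)
  then have "2 - 1 / l\<^sup>2 \<le> l\<^sup>2 - 2 * \<theta> * l * (1 - 1 / l\<^sup>2) + \<theta>\<^sup>2"
    by (metis diff_ge_0_iff_ge zero_le_power2)
  then show ?thesis
    using True assms by (simp add: loss_Frobenius c_tilde_sq)
next
  case False
  then show ?thesis
    using assms by (simp add: loss_Frobenius c_tilde_sq real_le_rsqrt)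
qed

lemma loss_Frobenius_optimal_shrinker:
  assumes "l > 0"
  shows "loss Frobenius l (optimal_shrinker Frobenius l) =
    (if l > 1 then sqrt (2 - 1 / l\<^sup>2) else l)"
proof (cases "l > 1")
  case True
  then have "1 / l < l"
    using less_trans[of "1 / l" 1 l] by simp
  moreover have "l\<^sup>2 - 2 * (l - 1 / l) * l * (1 - 1 / l\<^sup>2) + (l - 1 / l)\<^sup>2 = 2 - 1 / l\<^sup>2"
    using assms by (simp add: field_simps power2_eq_square)
  ultimately show ?thesis
    using True assms by (simp add: loss_Frobenius c_tilde_sq max_def)
next
  case False
  then have "l \<le> 1 / l"
    using assms by (simp add: field_simps mult_le_one)
  then show ?thesis
    using False assms by (simp add: loss_Frobenius c_tilde_sq max_def)
qed

text \<open>The image of any unit vector bounds the operator norm from below; a vector orthogonal to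
  \<open>u\<close> removes the dependence on \<open>\<theta>\<close>.\<close>

lemma loss_Operator_ge:
  assumes "l > 0"
  shows "l * s_tilde l \<le> loss Operator l \<theta>"
proof -
  let ?v = "vector [s_tilde l, - c_tilde l] :: real ^ 2"
  have "s_tilde l \<ge> 0"
    using assms by (simp add: s_tilde_eq)
  have Mv: "(loss_matrix l \<theta> *v ?v) $ 1 = l * s_tilde l" "(loss_matrix l \<theta> *v ?v) $ 2 = 0"
    by (simp_all add: matrix_vector_mult_2 loss_matrix_nth power2_eq_square algebra_simps)
  have "norm (loss_matrix l \<theta> *v ?v) = l * s_tilde l"
    using assms \<open>s_tilde l \<ge> 0\<close> by (simp add: norm_2 Mv)
  moreover have "norm ?v = 1"
    using c_tilde_sq_add_s_tilde_sq[OF assms] by (simp add: norm_2 add.commute)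
  ultimately show ?thesis
    using onorm[OF matrix_vector_mul_bounded_linear[of "loss_matrix l \<theta>"], of ?v]
    by (simp add: loss_def operator_norm_def)
qed

lemma loss_Operator_optimal_shrinker:
  assumes "l > 0"
  shows "loss Operator l (optimal_shrinker Operator l) = l * s_tilde l"
proof (rule antisym[OF _ loss_Operator_ge[OF assms]])
  let ?M = "loss_matrix l (optimal_shrinker Operator l)"
  let ?c = "c_tilde l" and ?s = "s_tilde l"
  have "?s \<ge> 0"
    using assms by (simp add: s_tilde_eq)
  have "(norm (?M *v x))\<^sup>2 \<le> (l * ?s * norm x)\<^sup>2" for x
  proof (cases "l > 1")
    case True
    have c2: "?c\<^sup>2 = 1 - ?s\<^sup>2"
      using c_tilde_sq_add_s_tilde_sq[OF assms] by simp
    \<comment> \<open>At \<open>\<theta> = l\<close> the diagonal entries are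
      \<open>l * ?s\<^sup>2\<close> and its negative, so \<open>l * ?s\<close> factors out of the
      whole matrix.\<close>
    have "(norm (?M *v x))\<^sup>2 =
        (l * ?s)\<^sup>2 * ((?s * x $ 1 - ?c * x $ 2)\<^sup>2 + (?c * x $ 1 + ?s * x $ 2)\<^sup>2)"
      using True
      by (simp add: norm_2 matrix_vector_mult_2 loss_matrix_nth c2)
        (simp add: power2_eq_square algebra_simps)
    also have "\<dots> = (l * ?s)\<^sup>2 * ((?c\<^sup>2 + ?s\<^sup>2) * ((x $ 1)\<^sup>2 + (x $ 2)\<^sup>2))"
      by (simp add: power2_eq_square algebra_simps)
    also have "\<dots> = (l * ?s * norm x)\<^sup>2"
      using assms by (simp add: c_tilde_sq_add_s_tilde_sq norm_2 power_mult_distrib)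
    finally show ?thesis
      by simp
  next
    \<comment> \<open>Now \<open>?c = 0\<close>, \<open>?s = 1\<close> and
      \<open>\<theta> = 0\<close>, so the matrix is \<open>l\<close> times the projection to the
      first axis.\<close>
    case False
    then show ?thesis
      using assms
      by (simp add: norm_2 matrix_vector_mult_2 loss_matrix_nth s_tilde_eq power_mult_distrib)
  qed
  moreover have "0 \<le> l * ?s * norm x" for x :: "real ^ 2"
    using assms \<open>?s \<ge> 0\<close> by simp
  ultimately have "norm (?M *v x) \<le> l * ?s * norm x" for x
    by (rule power2_le_imp_le)
  then show "loss Operator l (optimal_shrinker Operator l) \<le> l * ?s"
    unfolding loss_def matrix_norm.simps operator_norm_def by (intro onorm_le)
qed

lemma sqrt_two_less_iff:
  assumes "l > 0"
  shows "sqrt 2 < l \<longleftrightarrow> 2 < l\<^sup>2"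
  using assms real_sqrt_less_iff[of 2 "l\<^sup>2"] by simp

text \<open>On the branch \<open>\<theta> \<ge> 0\<close> the vertex is
  \<open>l * ((c_tilde l)\<^sup>2 - (s_tilde l)\<^sup>2)\<close>. It is positive exactly when
  \<open>l > sqrt 2\<close>, and then equals \<open>l - 2 / l\<close>; otherwise the minimum sits at
  the kink \<open>\<theta> = 0\<close>.\<close>

lemma loss_Nuclear_ge:
  assumes "l > 0"
  shows "(if l > sqrt 2 then 2 * sqrt (1 - 1 / l\<^sup>2) else l) \<le> loss Nuclear l \<theta>"
proof (cases "l > sqrt 2")
  case True
  then have "l > 1"
    using real_sqrt_gt_1_iff[of 2] by linarith
  have "4 * (1 - 1 / l\<^sup>2) \<le> (\<theta> - (l - 2 / l))\<^sup>2 + 4 * (1 - 1 / l\<^sup>2)"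
    by simp
  also have "\<dots> = l\<^sup>2 - 2 * \<theta> * l * (1 - 1 / l\<^sup>2) + \<theta>\<^sup>2 + 2 * \<theta> * (1 / l)"
    using assms by (simp add: field_simps power2_eq_square)
  \<comment> \<open>The quadratic of the branch \<open>\<theta> \<ge> 0\<close> stays below the true
    one for negative \<open>\<theta>\<close>, so no case split is needed.\<close>
  also have "\<dots> \<le> l\<^sup>2 - 2 * \<theta> * l * (1 - 1 / l\<^sup>2) + \<theta>\<^sup>2 + 2 * \<bar>\<theta>\<bar> * (1 / l)"
    using assms by (intro add_left_mono mult_right_mono) auto
  also have "\<dots> = l\<^sup>2 - 2 * \<theta> * l * (c_tilde l)\<^sup>2 + \<theta>\<^sup>2 + 2 * \<bar>\<theta>\<bar> * l * (s_tilde l)\<^sup>2"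
    using \<open>l > 1\<close> by (simp add: c_tilde_sq s_tilde_eq power_divide) (simp add: power2_eq_square)
  finally have "sqrt (4 * (1 - 1 / l\<^sup>2)) \<le> loss Nuclear l \<theta>"
    using assms by (simp add: loss_Nuclear)
  then show ?thesis
    using True real_sqrt_mult[of 4 "1 - 1 / l\<^sup>2"] by simp
next
  case False
  then have "1 \<le> 2 * (1 / l\<^sup>2)"
    using assms by (simp add: sqrt_two_less_iff le_divide_eq)
  then have "(c_tilde l)\<^sup>2 \<le> (s_tilde l)\<^sup>2"
    using assms by (auto simp: c_tilde_sq s_tilde_eq power_divide)
  \<comment> \<open>This makes the part of the radicand that is linear in \<open>\<theta>\<close>
    and \<open>\<bar>\<theta>\<bar>\<close> nonnegative.\<close>
  then have "\<theta> * (c_tilde l)\<^sup>2 \<le> \<bar>\<theta>\<bar> * (s_tilde l)\<^sup>2"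
    by (intro mult_mono) auto
  then have "0 \<le> \<theta>\<^sup>2 + 2 * l * (\<bar>\<theta>\<bar> * (s_tilde l)\<^sup>2 - \<theta> * (c_tilde l)\<^sup>2)"
    using assms by simp
  also have "\<dots> = \<theta>\<^sup>2 - 2 * \<theta> * l * (c_tilde l)\<^sup>2 + 2 * \<bar>\<theta>\<bar> * l * (s_tilde l)\<^sup>2"
    by (simp add: algebra_simps)
  finally have "l\<^sup>2 \<le> l\<^sup>2 - 2 * \<theta> * l * (c_tilde l)\<^sup>2 + \<theta>\<^sup>2 + 2 * \<bar>\<theta>\<bar> * l * (s_tilde l)\<^sup>2"
    by simp
  then show ?thesis
    using False assms by (simp add: loss_Nuclear real_le_rsqrt)
qed

lemma loss_Nuclear_optimal_shrinker:
  assumes "l > 0"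
  shows "loss Nuclear l (optimal_shrinker Nuclear l) =
    (if l > sqrt 2 then 2 * sqrt (1 - 1 / l\<^sup>2) else l)"
proof (cases "l > sqrt 2")
  case True
  then have "l > 1"
    using real_sqrt_gt_1_iff[of 2] by linarith
  \<comment> \<open>Positivity removes both the truncation in the shrinker and the absolute value in
    the loss.\<close>
  have "l - 2 / l > 0"
    using True assms by (simp add: sqrt_two_less_iff field_simps power2_eq_square)
  moreover have "l\<^sup>2 - 2 * (l - 2 / l) * l * (1 - 1 / l\<^sup>2) + (l - 2 / l)\<^sup>2
      + 2 * (l - 2 / l) * l * (1 / l)\<^sup>2 = 4 * (1 - 1 / l\<^sup>2)"
    using assms by (simp add: field_simps power2_eq_square)
  ultimately have "loss Nuclear l (optimal_shrinker Nuclear l) = sqrt (4 * (1 - 1 / l\<^sup>2))"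
    using \<open>l > 1\<close> assms by (simp add: loss_Nuclear c_tilde_sq s_tilde_eq)
  then show ?thesis
    using True real_sqrt_mult[of 4 "1 - 1 / l\<^sup>2"] by simp
next
  case False
  then have "l - 2 / l \<le> 0"
    using assms by (simp add: sqrt_two_less_iff field_simps power2_eq_square)
  then have "optimal_shrinker Nuclear l = 0"
    by simp
  then show ?thesis
    using False assms by (simp add: loss_Nuclear)
qed

theorem lemma3p3:
  fixes l :: real
  assumes "l > 0"
  shows "(\<forall>k. (\<forall>\<theta>. loss k l (optimal_shrinker k l) \<le> loss k l \<theta>) \<and>
              optimal_loss k l = loss k l (optimal_shrinker k l)) \<and>
         optimal_loss Frobenius l = (if l > 1 then sqrt (2 - 1 / l\<^sup>2) else l) \<and>
         optimal_loss Operator l = (if l > 1 then 1 else l) \<and>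
         optimal_loss Nuclear l = (if l > sqrt 2 then 2 * sqrt (1 - 1 / l\<^sup>2) else l)"
proof -
  note F = optimal_lossI[OF loss_Frobenius_ge loss_Frobenius_optimal_shrinker, OF assms assms]
  note O = optimal_lossI[OF loss_Operator_ge loss_Operator_optimal_shrinker, OF assms assms]
  note N = optimal_lossI[OF loss_Nuclear_ge loss_Nuclear_optimal_shrinker, OF assms assms]
  have "(\<forall>\<theta>. loss k l (optimal_shrinker k l) \<le> loss k l \<theta>) \<and>
      optimal_loss k l = loss k l (optimal_shrinker k l)" for k
    using F O N by (cases k) blast+
  \<comment> \<open>The operator minimum was carried as \<open>l * s_tilde l\<close>, which avoids a
    case split in its lower bound.\<close>
  moreover have "l * s_tilde l = (if l > 1 then 1 else l)"
    using assms by (simp add: s_tilde_eq)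
  ultimately show ?thesis
    using F O N by presburger
qed

end
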